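(* Let $\mathcal{G}$ be an undirected, connected, weighted graph with $N$ vertices and let $g\in\mathbb{R}^N$ be a window. If $\hat g(0)\ne0$, then $\{g_{i,k}\}_{i=1,\dots,N;\,k=0,\dots,N-1}$ is a frame; i.e., for all $f\in\mathbb{R}^N$, $$A\|f\|_2^2\le\sum_{i=1}^N\sum_{k=0}^{N-1}|\langle f,g_{i,k}\rangle|^2\le B\|f\|_2^2,$$ where $$0<N|\hat g(0)|^2\le A:=\min_{n\in\{1,\dots,N\}}\{N\|T_n g\|_2^2\}\le B:=\max_{n\in\{1,\dots,N\}}\{N\|T_n g\|_2^2\}\le N^2\mu^2\|g\|_2^2.$$
   Context: Setting: $\mathcal{G}=\{\mathcal{V},\mathcal{E},W\}$ is a finite undirected, connected, weighted graph with vertices $\{1,\dots,N\}$, where $W$ is a symmetric weighted adjacency matrix (non-negative entries, zero diagonal, $W_{mn}>0$ iff $(m,n)\in\mathcal{E}$). $D$ is the diagonal matrix of degrees $d_n=\sum_{m\ne n}W_{mn}$ and $\mathcal{L}=D-W$ is the graph Laplacian. $\{\chi_\ell\}_{\ell=0,\dots,N-1}$ is a fixed orthonormal basis of eigenvectors of $\mathcal{L}$ (possibly complex-valued) with eigenvalues $0=\lambda_0<\lambda_1\le\dots\le\lambda_{N-1}$, and $\chi_0(n)=1/\sqrt N$ for all $n$. A superscript $*$ on a scalar denotes complex conjugation. The inner product $\langle f,h\rangle=\sum_n f(n)h(n)^*$ is conjugate-linear in the second argument. The graph Fourier transform is $\hat g(\lambda_\ell):=\langle g,\chi_\ell\rangle=\sum_{n=1}^N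 g(n)\chi_\ell^*(n)$ (a vector indexed by $\ell$, one entry per $\ell$ also when eigenvalues repeat); $\hat g(0)$ means $\hat g(\lambda_0)$. The coherence is $\mu:=\max_{\ell,i}|\chi_\ell(i)|$. Generalized translation: $(T_i g)(n):=\sqrt N\sum_{\ell=0}^{N-1}\hat g(\lambda_\ell)\chi_\ell^*(i)\chi_\ell(n)$. Generalized modulation: $(M_k f)(n):=\sqrt N f(n)\chi_k(n)$. Windowed graph Fourier atoms: $g_{i,k}:=M_kT_i g$, i.e. $g_{i,k}(n)=N\chi_k(n)\sum_{\ell=0}^{N-1}\hat g(\lambda_\ell)\chi_\ell^*(i)\chi_\ell(n)$. *)

theory Defs
  imports "HOL-Analysis.Analysis"
begin

text \<open>
  Vertices are the elements of a finite type \<open>'v\<close>, so \<open>N = CARD('v)\<close>. An undirected edge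
  \<open>{m, n}\<close> is represented by the two ordered pairs \<open>(m, n)\<close> and \<open>(n, m)\<close>.
\<close>

definition weighted_graph :: "('v \<times> 'v) set \<Rightarrow> real^'v^'v::finite \<Rightarrow> bool" where
  "weighted_graph E W \<longleftrightarrow>
     (\<forall>m n. W $ m $ n = W $ n $ m) \<and>
     (\<forall>m n. 0 \<le> W $ m $ n) \<and>
     (\<forall>n. W $ n $ n = 0) \<and>
     (\<forall>m n. 0 < W $ m $ n \<longleftrightarrow> (m, n) \<in> E)"

definition graph_connected :: "('v \<times> 'v) set \<Rightarrow> bool" where
  "graph_connected E \<longleftrightarrow> (\<forall>m n. (m, n) \<in> E\<^sup>*)"

definition degree_matrix :: "real^'v^'v::finite \<Rightarrow> real^'v^'v" where
  "degree_matrix W = (\<chi> m n. if m = n then (\<Sum>k\<in>UNIV - {n}. W $ k $ n) else 0)"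

definition laplacian :: "real^'v^'v::finite \<Rightarrow> real^'v^'v" where
  "laplacian W = degree_matrix W - W"

text \<open>The library's \<^const>\<open>inner\<close> is real-valued, also on complex vectors.\<close>

definition cinner :: "complex^'v::finite \<Rightarrow> complex^'v \<Rightarrow> complex" where
  "cinner f h = (\<Sum>n\<in>UNIV. f $ n * cnj (h $ n))"

definition cvec :: "real^'v::finite \<Rightarrow> complex^'v" where
  "cvec f = (\<chi> n. complex_of_real (f $ n))"

definition orthonormal_basis :: "(nat \<Rightarrow> complex^'v::finite) \<Rightarrow> bool" where
  "orthonormal_basis u \<longleftrightarrow>
     (\<forall>k<CARD('v). \<forall>l<CARD('v). cinner (u k) (u l) = (if k = l then 1 else 0)) \<and>
     vec.span (u ` {..<CARD('v)}) = UNIV"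

text \<open>
  Only the values of \<open>u\<close> and \<open>lam\<close> at indices below \<open>CARD('v)\<close> are relevant. The eigenvalue
  \<open>lam 1\<close> is positive only if there is such an index, that is, if \<open>CARD('v) > 1\<close>.
\<close>

definition laplacian_eigenbasis ::
    "real^'v^'v::finite \<Rightarrow> (nat \<Rightarrow> complex^'v) \<Rightarrow> (nat \<Rightarrow> real) \<Rightarrow> bool" where
  "laplacian_eigenbasis W u lam \<longleftrightarrow>
     orthonormal_basis u \<and>
     (\<forall>l<CARD('v). map_matrix complex_of_real (laplacian W) *v u l
                     = complex_of_real (lam l) *s u l) \<and>
     lam 0 = 0 \<and>
     (1 < CARD('v) \<longrightarrow> 0 < lam 1) \<and>
     (\<forall>k l. k \<le> l \<and> l < CARD('v) \<longrightarrow> lam k \<le> lam l) \<and>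
     (\<forall>n. u 0 $ n = complex_of_real (1 / sqrt (real CARD('v))))"

text \<open>
  The transform is indexed by \<open>l\<close> rather than by the eigenvalue, so that repeated eigenvalues
  give separate entries.
\<close>

definition gft :: "(nat \<Rightarrow> complex^'v::finite) \<Rightarrow> complex^'v \<Rightarrow> nat \<Rightarrow> complex" where
  "gft u g l = cinner g (u l)"

definition coherence :: "(nat \<Rightarrow> complex^'v::finite) \<Rightarrow> real" where
  "coherence u = Max {cmod (u l $ i) | l i. l < CARD('v)}"

definition translate ::
    "(nat \<Rightarrow> complex^'v::finite) \<Rightarrow> 'v \<Rightarrow> complex^'v \<Rightarrow> complex^'v" where
  "translate u i g = (\<chi> n. complex_of_real (sqrt (real CARD('v))) *
     (\<Sum>l<CARD('v). gft u g l * cnj (u l $ i) * u l $ n))"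

definition modulate ::
    "(nat \<Rightarrow> complex^'v::finite) \<Rightarrow> nat \<Rightarrow> complex^'v \<Rightarrow> complex^'v" where
  "modulate u k f = (\<chi> n. complex_of_real (sqrt (real CARD('v))) * f $ n * u k $ n)"

definition atom ::
    "(nat \<Rightarrow> complex^'v::finite) \<Rightarrow> complex^'v \<Rightarrow> 'v \<Rightarrow> nat \<Rightarrow> complex^'v" where
  "atom u g i k = modulate u k (translate u i g)"

text \<open>The frame inequality ranges over real signals, although the frame elements may be complex.\<close>

definition is_frame :: "'i set \<Rightarrow> ('i \<Rightarrow> complex^'v::finite) \<Rightarrow> bool" where
  "is_frame I \<phi> \<longleftrightarrow>
     (\<exists>A B. 0 < A \<and> A \<le> B \<and>
       (\<forall>f :: real^'v.
          A * (norm f)\<^sup>2 \<le> (\<Sum>j\<in>I. (cmod (cinner (cvec f) (\<phi> j)))\<^sup>2) \<and>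
          (\<Sum>j\<in>I. (cmod (cinner (cvec f) (\<phi> j)))\<^sup>2) \<le> B * (norm f)\<^sup>2))"

end

theory Submission
  imports Defs
begin

text \<open>
  For a fixed vertex \<open>i\<close>, the numbers \<open>\<langle>f, g\<^sub>i\<^sub>,\<^sub>k\<rangle>\<close> are, up to the factor \<open>\<surd>N\<close>, the graph Fourier
  coefficients of the windowed signal \<open>n \<mapsto> f(n) (T\<^sub>i g)(n)\<^sup>*\<close>. Parseval's identity therefore removes
  the sum over \<open>k\<close>, leaving \<open>N \<Sum>\<^sub>n |f(n)|\<^sup>2 |(T\<^sub>i g)(n)|\<^sup>2\<close>. What remains is the sum over \<open>i\<close> at each
  fixed \<open>n\<close>. When the eigenvectors are complex, \<open>|(T\<^sub>i g)(n)|\<close> and \<open>|(T\<^sub>n g)(i)|\<close> may differ, but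
  orthonormality gives both \<open>\<Sum>\<^sub>i |(T\<^sub>i g)(n)|\<^sup>2\<close> and \<open>\<parallel>T\<^sub>n g\<parallel>\<^sup>2\<close> the same value,
  \<open>N \<Sum>\<^sub>l |\<chi>\<^sub>l(n)|\<^sup>2 |\<langle>g, \<chi>\<^sub>l\<rangle>|\<^sup>2\<close> (lemmas \<open>norm_translate\<close> and \<open>sum_translate\<close>). Hence
  the total energy is \<open>\<Sum>\<^sub>n |f(n)|\<^sup>2 \<cdot> N \<parallel>T\<^sub>n g\<parallel>\<^sup>2\<close> (lemma \<open>frame_energy\<close>): the frame operator is the
  multiplication by \<open>N \<parallel>T\<^sub>n g\<parallel>\<^sup>2\<close>, and its extreme values are the frame bounds.

  The estimates of the bounds follow from the same formula for \<open>\<parallel>T\<^sub>n g\<parallel>\<^sup>2\<close>. Keeping only the term of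
  the constant eigenvector, where \<open>|\<chi>\<^sub>0(n)|\<^sup>2 = 1/N\<close>, bounds it from below; replacing every
  \<open>|\<chi>\<^sub>l(n)|\<close> by the coherence and applying Parseval's identity to \<open>g\<close> bounds it from above.
\<close>

section \<open>The Hermitian inner product and orthonormal bases\<close>

lemma cinner_sum_left: "cinner (\<Sum>k\<in>S. f k) h = (\<Sum>k\<in>S. cinner (f k) h)"
  unfolding cinner_def by (simp add: sum_distrib_right) (rule sum.swap)

lemma cinner_scale_left: "cinner (c *s f) h = c * cinner f h"
  unfolding cinner_def by (simp add: sum_distrib_left mult.assoc)

lemma cinner_add_left: "cinner (f + f') h = cinner f h + cinner f' h"
  unfolding cinner_def by (simp add: distrib_right sum.distrib)

lemma cnj_cinner: "cnj (cinner f h) = cinner h f"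
  unfolding cinner_def by (simp add: mult.commute)

lemma power2_norm_vec_eq_sum:
  fixes f :: "'a::real_normed_vector^'v::finite"
  shows "(norm f)\<^sup>2 = (\<Sum>n\<in>UNIV. (norm (f $ n))\<^sup>2)"
  by (simp add: norm_vec_def L2_set_def sum_nonneg)

lemma cinner_self: "cinner f f = complex_of_real ((norm f)\<^sup>2)"
  unfolding cinner_def power2_norm_vec_eq_sum by (simp only: complex_norm_square of_real_sum)

lemma norm_cvec [simp]: "norm (cvec f) = norm f"
  by (simp add: norm_vec_def cvec_def L2_set_def)

lemma cinner_combination_left:
  "cinner (\<Sum>l\<in>S. c l *s u l) h = (\<Sum>l\<in>S. c l * cinner (u l) h)"
  by (simp add: cinner_sum_left cinner_scale_left)

lemma cinner_combination_basis:
  fixes u :: "nat \<Rightarrow> complex^'v::finite"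
  assumes "orthonormal_basis u" "k < CARD('v)"
  shows "cinner (\<Sum>l<CARD('v). c l *s u l) (u k) = c k"
proof -
  have "cinner (\<Sum>l<CARD('v). c l *s u l) (u k)
      = (\<Sum>l<CARD('v). if l = k then c l else 0)"
    unfolding cinner_combination_left
    using assms by (intro sum.cong) (auto simp: orthonormal_basis_def)
  then show ?thesis
    using assms by simp
qed

lemma norm_orthonormal_combination:
  fixes u :: "nat \<Rightarrow> complex^'v::finite"
  assumes "orthonormal_basis u"
  shows "(norm (\<Sum>l<CARD('v). c l *s u l))\<^sup>2 = (\<Sum>l<CARD('v). (cmod (c l))\<^sup>2)"
proof -
  let ?f = "\<Sum>l<CARD('v). c l *s u l"
  have "complex_of_real ((norm ?f)\<^sup>2) = (\<Sum>l<CARD('v). c l * cinner (u l) ?f)"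
    by (simp only: cinner_self [symmetric] cinner_combination_left)
  also have "\<dots> = (\<Sum>l<CARD('v). c l * cnj (c l))"
    using cinner_combination_basis [OF assms, of _ c]
    by (intro sum.cong) (auto simp: cnj_cinner [of ?f, symmetric])
  also have "\<dots> = complex_of_real (\<Sum>l<CARD('v). (cmod (c l))\<^sup>2)"
    by (simp only: complex_norm_square of_real_sum)
  finally show ?thesis
    by (simp only: of_real_eq_iff)
qed

text \<open>
  The vectors that equal their own expansion form a subspace, and by orthonormality it contains the
  basis; so it contains the span.
\<close>

lemma orthonormal_expansion:
  fixes u :: "nat \<Rightarrow> complex^'v::finite"
  assumes "orthonormal_basis u"
  shows "(\<Sum>l<CARD('v). cinner f (u l) *s u l) = f"
proof -
  have "f \<in> vec.span (u ` {..<CARD('v)})"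
    using assms by (simp add: orthonormal_basis_def)
  then show ?thesis
  proof (induction rule: vec.span_induct_alt)
    case base
    show ?case
      by (simp add: cinner_def)
  next
    case (step c x f)
    then obtain k where k: "k < CARD('v)" and x: "x = u k"
      by auto
    have "(\<Sum>l<CARD('v). cinner x (u l) *s u l) = (\<Sum>l<CARD('v). if l = k then u l else 0)"
      using assms k by (intro sum.cong) (auto simp: orthonormal_basis_def x)
    also have "\<dots> = x"
      using k by (simp add: x)
    finally have "c *s (\<Sum>l<CARD('v). cinner x (u l) *s u l) = c *s x"
      by simp
    with step.IH show ?case
      by (simp add: cinner_add_left cinner_scale_left vec.scale_left_distrib sum.distrib
          vec.scale_sum_right)
  qed
qed

lemma parseval:
  fixes u :: "nat \<Rightarrow> complex^'v::finite"
  assumes "orthonormal_basis u"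
  shows "(\<Sum>l<CARD('v). (cmod (gft u f l))\<^sup>2) = (norm f)\<^sup>2"
  using norm_orthonormal_combination [OF assms, of "gft u f"] orthonormal_expansion [OF assms, of f]
  by (simp add: gft_def)

section \<open>Energy of translated windows\<close>

text \<open>
  By definition \<open>T\<^sub>n g\<close> is \<open>\<surd>N\<close> times an expansion in the basis, so its norm is read off from the
  coefficients.
\<close>

lemma norm_translate:
  fixes u :: "nat \<Rightarrow> complex^'v::finite"
  assumes "orthonormal_basis u"
  shows "(norm (translate u n g))\<^sup>2
    = real CARD('v) * (\<Sum>l<CARD('v). (cmod (u l $ n))\<^sup>2 * (cmod (gft u g l))\<^sup>2)"
proof -
  let ?h = "\<Sum>l<CARD('v). (gft u g l * cnj (u l $ n)) *s u l"
  have "(norm (translate u n g))\<^sup>2 = real CARD('v) * (norm ?h)\<^sup>2"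
  proof -
    have "translate u n g $ i = complex_of_real (sqrt (real CARD('v))) * ?h $ i" for i
      by (simp add: translate_def)
    then show ?thesis
      unfolding power2_norm_vec_eq_sum
      by (simp only: norm_mult power_mult_distrib sum_distrib_left) simp
  qed
  then show ?thesis
    by (simp add: norm_orthonormal_combination [OF assms] norm_mult power_mult_distrib mult.commute)
qed

text \<open>
  As a function of \<open>i\<close>, the value \<open>(T\<^sub>i g)(n)\<close> is an expansion in the conjugates of the basis
  vectors. Its modulus is that of the conjugate, an expansion in the basis itself.
\<close>

lemma sum_translate:
  fixes u :: "nat \<Rightarrow> complex^'v::finite"
  assumes "orthonormal_basis u"
  shows "(\<Sum>i\<in>UNIV. (cmod (translate u i g $ n))\<^sup>2) = (norm (translate u n g))\<^sup>2"
proof -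
  let ?h = "\<Sum>l<CARD('v). cnj (gft u g l * u l $ n) *s u l"
  have "cmod (translate u i g $ n) = sqrt (real CARD('v)) * cmod (?h $ i)" for i
  proof -
    have "translate u i g $ n = complex_of_real (sqrt (real CARD('v))) * cnj (?h $ i)"
      by (simp add: translate_def mult_ac)
    then show ?thesis
      by (simp only: norm_mult complex_mod_cnj) simp
  qed
  then have "(\<Sum>i\<in>UNIV. (cmod (translate u i g $ n))\<^sup>2) = real CARD('v) * (norm ?h)\<^sup>2"
    by (simp only: power2_norm_vec_eq_sum [of ?h])
      (simp add: power_mult_distrib sum_distrib_left)
  then show ?thesis
    unfolding norm_translate [OF assms] norm_orthonormal_combination [OF assms]
    by (simp add: norm_mult power_mult_distrib mult.commute)
qed

lemma norm_translate_ge: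
  fixes u :: "nat \<Rightarrow> complex^'v::finite"
  assumes "orthonormal_basis u"
    and const: "\<And>n. u 0 $ n = complex_of_real (1 / sqrt (real CARD('v)))"
  shows "(cmod (gft u g 0))\<^sup>2 \<le> (norm (translate u n g))\<^sup>2"
proof -
  have "(cmod (u 0 $ n))\<^sup>2 * (cmod (gft u g 0))\<^sup>2
      \<le> (\<Sum>l<CARD('v). (cmod (u l $ n))\<^sup>2 * (cmod (gft u g l))\<^sup>2)"
    by (rule member_le_sum) auto
  moreover have "(cmod (u 0 $ n))\<^sup>2 = 1 / real CARD('v)"
    by (simp add: const norm_divide power_divide)
  ultimately show ?thesis
    unfolding norm_translate [OF assms(1)] by (simp add: field_simps)
qed

lemma cmod_le_coherence:
  fixes u :: "nat \<Rightarrow> complex^'v::finite"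
  assumes "l < CARD('v)"
  shows "cmod (u l $ i) \<le> coherence u"
proof -
  have "{cmod (u l $ i) |l i. l < CARD('v)} = (\<lambda>(l, i). cmod (u l $ i)) ` ({..<CARD('v)} \<times> UNIV)"
    by auto
  then have "finite {cmod (u l $ i) |l i. l < CARD('v)}"
    by simp
  then show ?thesis
    unfolding coherence_def using assms by (intro Max_ge) auto
qed

lemma norm_translate_le:
  fixes u :: "nat \<Rightarrow> complex^'v::finite"
  assumes "orthonormal_basis u"
  shows "(norm (translate u n g))\<^sup>2 \<le> real CARD('v) * ((coherence u)\<^sup>2 * (norm g)\<^sup>2)"
proof -
  have "(\<Sum>l<CARD('v). (cmod (u l $ n))\<^sup>2 * (cmod (gft u g l))\<^sup>2)
      \<le> (\<Sum>l<CARD('v). (coherence u)\<^sup>2 * (cmod (gft u g l))\<^sup>2)"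
    by (intro sum_mono mult_right_mono power_mono cmod_le_coherence) auto
  also have "\<dots> = (coherence u)\<^sup>2 * (norm g)\<^sup>2"
    by (simp only: sum_distrib_left [symmetric] parseval [OF assms])
  finally show ?thesis
    unfolding norm_translate [OF assms] by (intro mult_left_mono) auto
qed

section \<open>Energy of the windowed graph Fourier coefficients\<close>

lemma cinner_atom:
  fixes u :: "nat \<Rightarrow> complex^'v::finite"
  shows "cinner f (atom u g i k) = complex_of_real (sqrt (real CARD('v))) *
    gft u (\<chi> n. f $ n * cnj (translate u i g $ n)) k"
  by (simp add: cinner_def atom_def modulate_def gft_def sum_distrib_left mult_ac)

lemma frame_energy:
  fixes u :: "nat \<Rightarrow> complex^'v::finite"
  assumes "orthonormal_basis u"
  shows "(\<Sum>i\<in>UNIV. \<Sum>k<CARD('v). (cmod (cinner f (atom u g i k)))\<^sup>2)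
    = (\<Sum>n\<in>UNIV. real CARD('v) * (norm (translate u n g))\<^sup>2 * (cmod (f $ n))\<^sup>2)"
proof -
  have "(\<Sum>k<CARD('v). (cmod (cinner f (atom u g i k)))\<^sup>2)
      = (\<Sum>n\<in>UNIV. real CARD('v) * (cmod (translate u i g $ n))\<^sup>2 * (cmod (f $ n))\<^sup>2)" for i
  proof -
    have "(\<Sum>k<CARD('v). (cmod (cinner f (atom u g i k)))\<^sup>2)
        = real CARD('v) * (norm (\<chi> n. f $ n * cnj (translate u i g $ n)))\<^sup>2"
      unfolding parseval [OF assms, symmetric]
      by (simp add: cinner_atom norm_mult power_mult_distrib sum_distrib_left)
    then show ?thesis
      by (simp add: power2_norm_vec_eq_sum norm_mult power_mult_distrib sum_distrib_left mult_ac)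
  qed
  then have "(\<Sum>i\<in>UNIV. \<Sum>k<CARD('v). (cmod (cinner f (atom u g i k)))\<^sup>2)
      = (\<Sum>n\<in>UNIV. \<Sum>i\<in>UNIV.
          real CARD('v) * (cmod (translate u i g $ n))\<^sup>2 * (cmod (f $ n))\<^sup>2)"
    by (simp only:) (rule sum.swap)
  then show ?thesis
    by (simp only: sum_translate [OF assms, symmetric] sum_distrib_left sum_distrib_right)
qed

section \<open>Frame bounds\<close>

theorem theorem3:
  fixes E :: "('v::finite \<times> 'v) set"
    and W :: "real^'v^'v"
    and u :: "nat \<Rightarrow> complex^'v"
    and lam :: "nat \<Rightarrow> real"
    and g :: "real^'v"
    and N :: nat
    and A B :: real
  assumes "N = CARD('v)"
    and "weighted_graph E W"
    and "graph_connected E"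
    and "laplacian_eigenbasis W u lam"
    and "gft u (cvec g) 0 \<noteq> 0"
    and "A = (MIN n. real N * (norm (translate u n (cvec g)))\<^sup>2)"
    and "B = (MAX n. real N * (norm (translate u n (cvec g)))\<^sup>2)"
  shows "is_frame (UNIV \<times> {..<N}) (\<lambda>(i, k). atom u (cvec g) i k) \<and>
    (\<forall>f :: real^'v.
       A * (norm f)\<^sup>2
         \<le> (\<Sum>i\<in>UNIV. \<Sum>k<N. (cmod (cinner (cvec f) (atom u (cvec g) i k)))\<^sup>2) \<and>
       (\<Sum>i\<in>UNIV. \<Sum>k<N. (cmod (cinner (cvec f) (atom u (cvec g) i k)))\<^sup>2)
         \<le> B * (norm f)\<^sup>2) \<and>
    0 < real N * (cmod (gft u (cvec g) 0))\<^sup>2 \<and>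
    real N * (cmod (gft u (cvec g) 0))\<^sup>2 \<le> A \<and>
    A \<le> B \<and>
    B \<le> (real N)\<^sup>2 * (coherence u)\<^sup>2 * (norm g)\<^sup>2"
proof -
  have onb: "orthonormal_basis u"
    and const: "u 0 $ n = complex_of_real (1 / sqrt (real CARD('v)))" for n
    using assms(4) by (auto simp: laplacian_eigenbasis_def)
  define w where "w n = real N * (norm (translate u n (cvec g)))\<^sup>2" for n
  have A: "A = Min (range w)" and B: "B = Max (range w)"
    using assms(6,7) by (simp_all add: w_def [abs_def])
  have A_le: "A \<le> w n" and le_B: "w n \<le> B" for n
    by (simp_all add: A B)
  have energy: "(\<Sum>i\<in>UNIV. \<Sum>k<N. (cmod (cinner (cvec f) (atom u (cvec g) i k)))\<^sup>2)
      = (\<Sum>n\<in>UNIV. w n * (norm (f $ n))\<^sup>2)" for f :: "real^'v"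
    unfolding assms(1) frame_energy [OF onb] by (simp add: w_def assms(1) cvec_def)
  have frame: "A * (norm f)\<^sup>2
      \<le> (\<Sum>i\<in>UNIV. \<Sum>k<N. (cmod (cinner (cvec f) (atom u (cvec g) i k)))\<^sup>2) \<and>
    (\<Sum>i\<in>UNIV. \<Sum>k<N. (cmod (cinner (cvec f) (atom u (cvec g) i k)))\<^sup>2)
      \<le> B * (norm f)\<^sup>2" for f :: "real^'v"
    unfolding energy power2_norm_vec_eq_sum [of f] sum_distrib_left
    by (intro conjI sum_mono mult_right_mono A_le le_B) auto
  have pos: "0 < real N * (cmod (gft u (cvec g) 0))\<^sup>2"
    using assms(1,5) by simp
  have lower: "real N * (cmod (gft u (cvec g) 0))\<^sup>2 \<le> A"
    unfolding A using norm_translate_ge [OF onb const, of "cvec g"]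
    by (auto simp: w_def intro!: mult_left_mono)
  have A_le_B: "A \<le> B"
    using A_le le_B by (rule order_trans)
  have upper: "B \<le> (real N)\<^sup>2 * (coherence u)\<^sup>2 * (norm g)\<^sup>2"
  proof -
    have "w n \<le> real N * (real N * ((coherence u)\<^sup>2 * (norm (cvec g))\<^sup>2))" for n
      unfolding w_def using norm_translate_le [OF onb, of n "cvec g"]
      by (intro mult_left_mono) (simp_all add: assms(1))
    then show ?thesis
      by (simp add: B power2_eq_square [of "real N"] mult.assoc)
  qed
  have "is_frame (UNIV \<times> {..<N}) (\<lambda>(i, k). atom u (cvec g) i k)"
    unfolding is_frame_def
  proof (intro exI conjI allI)
    show "0 < A"
      using pos lower by linarith
    show "A \<le> B"
      by (rule A_le_B)
  qed (use frame in \<open>simp_all add: sum.cartesian_product case_prod_unfold\<close>)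
  with frame pos lower A_le_B upper show ?thesis
    by blast
qed

end
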